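(* The index $KII$ is a continuous function of the matrix entries, i.e. for each order $n$, $KII: M_R\to\mathbb{R}$ is continuous, where the set $M_R$ of reciprocal matrices of order $n$ carries the topology induced from $\mathbb{R}^{n\times n}$.
   Context: $M_R$ is the set of all real $n\times n$ matrices $A=(a_{ij})$ with $a_{ij}>0$ for all $i,j$ and $a_{ij}=1/a_{ji}$ for all $i,j$ (reciprocal matrices). Koczkodaj's inconsistency index of $A\in M_R$ is $$KII(A)=\max_{i,j,k\in\{1,\dots,n\}}\ \min\left(\left|1-\frac{a_{ik}}{a_{ij}a_{jk}}\right|,\ \left|1-\frac{a_{ij}a_{jk}}{a_{ik}}\right|\right).$$ *)

theory Defs
  imports "HOL-Analysis.Analysis"
begin

definition reciprocal_matrices :: "(real ^ 'n ^ 'n) set" where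
  "reciprocal_matrices = {A. \<forall>i j. A $ i $ j > 0 \<and> A $ i $ j = 1 / A $ j $ i}"

text \<open>Koczkodaj's inconsistency index; it is only meaningful on reciprocal matrices,
  where no denominator vanishes.\<close>

definition KII :: "real ^ 'n ^ 'n \<Rightarrow> real" where
  "KII A = Max (range (\<lambda>(i, j, k).
     min \<bar>1 - A $ i $ k / (A $ i $ j * A $ j $ k)\<bar>
         \<bar>1 - (A $ i $ j * A $ j $ k) / A $ i $ k\<bar>))"

end

theory Submission
  imports Defs
begin

text \<open>For a fixed triple (i, j, k), the term under the maximum is built from matrix entries by
  products, quotients, differences, absolute values and \<open>min\<close>. Entries of a reciprocal
  matrix are positive, so no denominator vanishes and the term is continuous there. There are
  finitely many triples, and \<open>continuous_on_Max_image\<close> carries continuity over to their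
  maximum.\<close>

lemma continuous_on_Max_image:
  fixes f :: "'i \<Rightarrow> 'a::topological_space \<Rightarrow> 'b::linorder_topology"
  assumes "finite I" "I \<noteq> {}" "\<And>i. i \<in> I \<Longrightarrow> continuous_on S (f i)"
  shows "continuous_on S (\<lambda>x. Max ((\<lambda>i. f i x) ` I))"
  using assms
proof (induction I rule: finite_ne_induct)
  case (singleton i)
  then show ?case by simp
next
  case (insert i I)
  \<comment> \<open>As \<open>I\<close> is finite and nonempty, \<open>Max\<close> over
    \<open>insert i I\<close> splits into this binary \<open>max\<close>; starting from singletons
    avoids the unspecified \<open>Max {}\<close>.\<close>
  have "continuous_on S (\<lambda>x. max (f i x) (Max ((\<lambda>i. f i x) ` I)))"
    using insert by (intro continuous_on_max) auto
  then show ?case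
    using insert.hyps by simp
qed

theorem proposition16:
  shows "continuous_on (reciprocal_matrices :: (real ^ 'n ^ 'n) set) KII"
proof -
  let ?f = "\<lambda>(i, j, k) (A :: real ^ 'n ^ 'n).
    min \<bar>1 - A $ i $ k / (A $ i $ j * A $ j $ k)\<bar> \<bar>1 - (A $ i $ j * A $ j $ k) / A $ i $ k\<bar>"
  have nonzero: "A $ i $ j \<noteq> 0" if "A \<in> reciprocal_matrices" for A :: "real ^ 'n ^ 'n" and i j
    using that unfolding reciprocal_matrices_def by (metis (mono_tags, lifting) less_irrefl mem_Collect_eq)
  have "continuous_on reciprocal_matrices (?f t)" for t
    by (cases t) (auto intro!: continuous_intros continuous_on_min simp: nonzero)
  then have "continuous_on reciprocal_matrices (\<lambda>A. Max ((\<lambda>t. ?f t A) ` UNIV))"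
    by (intro continuous_on_Max_image) auto
  \<comment> \<open>\<open>?f\<close> takes the triple before the matrix, while
    \<open>KII_def\<close> fixes the matrix first; writing both with projections makes them
    agree.\<close>
  moreover have "KII = (\<lambda>A. Max ((\<lambda>t. ?f t A) ` UNIV))"
    unfolding KII_def by (simp add: case_prod_unfold)
  ultimately show ?thesis
    by (simp only:)
qed

end
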